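(* Let $\mathbb{K}$ be a field and let $(E,w,d)$ be a $\mathbb{V}$-ultra triple such that $E$ is finite. Let $\gamma\in\mathbb{V}$ satisfy $d(a,b)\le\gamma$ for all $(a,b)\in E\times_{\neq}E$, and let $u\in\mathbb{L}$. Assume $|\mathbb{K}|\ge\mathrm{mcs}(E,w,d)$. Then there exists a $(\gamma,u)$-positioned valadic $\mathbb{V}$-ultra triple isomorphic to $(E,w,d)$.
   Context: $\mathbb{V}$ is a totally ordered abelian group (translation-invariant order); $\mathbb{V}_{\ge0}=\{\alpha\in\mathbb{V}:\alpha\ge0\}$. $\mathbb{L}=\mathbb{K}[\mathbb{V}]$ is the group algebra with $\mathbb{K}$-basis $(t_\alpha)_{\alpha\in\mathbb{V}}$ and $t_\alpha t_\beta=t_{\alpha+\beta}$; $\mathbb{L}_+=\mathbb{K}[\mathbb{V}_{\ge0}]$ is the subalgebra spanned by $t_\alpha$, $\alpha\ge0$. $[t_\beta]a$ is the coefficient of $t_\beta$ in $a$; for nonzero $a$, $\mathrm{ord}\,a$ is the smallest $\beta$ with $[t_\beta]a\ne0$. $E\times_{\neq}E=\{(a,b)\in E\times E:a\ne b\}$. A $\mathbb{V}$-ultra triple is $(E,w,d)$ with $w:E\to\mathbb{V}$, $d:E\times_{\neq}E\to\mathbb{V}$ symmetric with $d(a,b)\le\max\{d(a,c),d(b,c)\}$ for distinct $a,b,c$. An $\alpha$-clique is $F\subseteq E$ with $d(a,b)=\alpha$ for all distinct $a,b\in F$; a clique is an $\alpha$-clique for some $\alpha$; $\mathrm{mcs}(E,w,d)$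 is the maximum size of a clique. A valadic $\mathbb{V}$-ultra triple is one of the form $(F,v,c)$ with $F\subseteq\mathbb{L}$, $v:F\to\mathbb{V}$ arbitrary, and $c(a,b)=-\mathrm{ord}(a-b)$. It is $(\gamma,u)$-positioned if $F\subseteq u+t_{-\gamma}\mathbb{L}_+$. An isomorphism $(E,w,d)\to(F,v,c)$ of $\mathbb{V}$-ultra triples is a bijection $f:E\to F$ with $v\circ f=w$ and $c(f(a),f(b))=d(a,b)$ for all $(a,b)\in E\times_{\neq}E$; two triples are isomorphic if such an $f$ exists. *)

theory Defs
  imports "HOL-Library.Poly_Mapping"
begin

text \<open>
  The value group is a type \<open>'v :: linordered_ab_group_add\<close> and the base field a type
  \<open>'k :: field\<close>.  The group algebra of \<open>'v\<close> over \<open>'k\<close> is the type \<open>'v \<Rightarrow>\<^sub>0 'k\<close> of finitely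
  supported functions with its convolution product; the coefficient of \<open>t \<beta>\<close> in \<open>a\<close> is
  \<open>lookup a \<beta>\<close>.
\<close>

definition t :: "'v::linordered_ab_group_add \<Rightarrow> ('v \<Rightarrow>\<^sub>0 'k::field)" where
  "t \<alpha> = Poly_Mapping.single \<alpha> 1"

lemma t_mult: "(t \<alpha> :: 'v::linordered_ab_group_add \<Rightarrow>\<^sub>0 'k::field) * t \<beta> = t (\<alpha> + \<beta>)"
  by (simp add: t_def mult_single)

definition L_plus :: "('v::linordered_ab_group_add \<Rightarrow>\<^sub>0 'k::field) set" where
  "L_plus = {a. Poly_Mapping.keys a \<subseteq> {0..}}"

text \<open>\<open>L_plus\<close> is the linear span of the \<open>t \<alpha>\<close> with \<open>\<alpha> \<ge> 0\<close>
  (multiplication by \<open>single 0 k\<close> is scalar multiplication by \<open>k\<close>).\<close>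

lemma L_plus_eq_span:
  "(L_plus :: ('v::linordered_ab_group_add \<Rightarrow>\<^sub>0 'k::field) set) =
     {\<Sum>\<alpha>\<in>A. Poly_Mapping.single 0 (k \<alpha>) * t \<alpha> | A k. finite A \<and> A \<subseteq> {0..}}"
proof (intro set_eqI iffI)
  fix a :: "'v \<Rightarrow>\<^sub>0 'k"
  assume "a \<in> L_plus"
  moreover have "a = (\<Sum>\<alpha>\<in>Poly_Mapping.keys a.
      Poly_Mapping.single 0 (Poly_Mapping.lookup a \<alpha>) * t \<alpha>)"
    by (rule poly_mapping_eqI)
       (simp add: t_def mult_single lookup_sum lookup_single when_def in_keys_iff)
  ultimately show "a \<in> {\<Sum>\<alpha>\<in>A. Poly_Mapping.single 0 (k \<alpha>) * t \<alpha> | A k.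
      finite A \<and> A \<subseteq> {0..}}"
    unfolding L_plus_def using finite_keys by blast
next
  fix a :: "'v \<Rightarrow>\<^sub>0 'k"
  assume "a \<in> {\<Sum>\<alpha>\<in>A. Poly_Mapping.single 0 (k \<alpha>) * t \<alpha> | A k. finite A \<and> A \<subseteq> {0..}}"
  then obtain A and k :: "'v \<Rightarrow> 'k" where a: "a = (\<Sum>\<alpha>\<in>A. Poly_Mapping.single \<alpha> (k \<alpha>))"
    and A: "finite A" "A \<subseteq> {0..}"
    by (auto simp: t_def mult_single)
  have "Poly_Mapping.keys a \<subseteq> A"
    using A(1) by (auto simp: a in_keys_iff lookup_sum lookup_single when_def split: if_splits)
  then show "a \<in> L_plus"
    using A(2) by (auto simp: L_plus_def)
qed

text \<open>Meaningful only for nonzero \<open>a\<close>.\<close>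

definition t_order :: "('v::linordered_ab_group_add \<Rightarrow>\<^sub>0 'k::field) \<Rightarrow> 'v" where
  "t_order a = Min {\<beta>. Poly_Mapping.lookup a \<beta> \<noteq> 0}"

text \<open>
  In a triple \<open>(E, w, d)\<close> the maps \<open>w\<close> and \<open>d\<close> are total functions of which only the values on
  \<open>E\<close>, respectively on pairs of distinct elements of \<open>E\<close>, are ever used.
\<close>

definition ultra_triple ::
    "'e set \<Rightarrow> ('e \<Rightarrow> 'v::linordered_ab_group_add) \<Rightarrow> ('e \<Rightarrow> 'e \<Rightarrow> 'v) \<Rightarrow> bool" where
  "ultra_triple E w d \<longleftrightarrow>
     (\<forall>a\<in>E. \<forall>b\<in>E. a \<noteq> b \<longrightarrow> d a b = d b a) \<and>
     (\<forall>a\<in>E. \<forall>b\<in>E. \<forall>c\<in>E. a \<noteq> b \<and> a \<noteq> c \<and> b \<noteq> c \<longrightarrow> d a b \<le> max (d a c) (d b c))"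

definition clique_at ::
    "'e set \<Rightarrow> ('e \<Rightarrow> 'v::linordered_ab_group_add) \<Rightarrow> ('e \<Rightarrow> 'e \<Rightarrow> 'v) \<Rightarrow> 'v \<Rightarrow> 'e set \<Rightarrow> bool" where
  "clique_at E w d \<alpha> F \<longleftrightarrow> F \<subseteq> E \<and> (\<forall>a\<in>F. \<forall>b\<in>F. a \<noteq> b \<longrightarrow> d a b = \<alpha>)"

definition clique ::
    "'e set \<Rightarrow> ('e \<Rightarrow> 'v::linordered_ab_group_add) \<Rightarrow> ('e \<Rightarrow> 'e \<Rightarrow> 'v) \<Rightarrow> 'e set \<Rightarrow> bool" where
  "clique E w d F \<longleftrightarrow> (\<exists>\<alpha>. clique_at E w d \<alpha> F)"

text \<open>Meaningful only for finite \<open>E\<close>.\<close>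

definition mcs ::
    "'e set \<Rightarrow> ('e \<Rightarrow> 'v::linordered_ab_group_add) \<Rightarrow> ('e \<Rightarrow> 'e \<Rightarrow> 'v) \<Rightarrow> nat" where
  "mcs E w d = Max {card F | F. clique E w d F}"

definition valadic ::
    "('v::linordered_ab_group_add \<Rightarrow>\<^sub>0 'k::field) set \<Rightarrow> (('v \<Rightarrow>\<^sub>0 'k) \<Rightarrow> 'v) \<Rightarrow>
     (('v \<Rightarrow>\<^sub>0 'k) \<Rightarrow> ('v \<Rightarrow>\<^sub>0 'k) \<Rightarrow> 'v) \<Rightarrow> bool" where
  "valadic F v c \<longleftrightarrow> ultra_triple F v c \<and> (\<forall>a\<in>F. \<forall>b\<in>F. a \<noteq> b \<longrightarrow> c a b = - t_order (a - b))"

definition positioned ::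
    "'v::linordered_ab_group_add \<Rightarrow> ('v \<Rightarrow>\<^sub>0 'k::field) \<Rightarrow> ('v \<Rightarrow>\<^sub>0 'k) set \<Rightarrow>
     (('v \<Rightarrow>\<^sub>0 'k) \<Rightarrow> 'v) \<Rightarrow> (('v \<Rightarrow>\<^sub>0 'k) \<Rightarrow> ('v \<Rightarrow>\<^sub>0 'k) \<Rightarrow> 'v) \<Rightarrow> bool" where
  "positioned \<gamma> u F v c \<longleftrightarrow> F \<subseteq> {u + t (- \<gamma>) * p | p. p \<in> L_plus}"

definition ultra_isomorphism ::
    "'e set \<Rightarrow> ('e \<Rightarrow> 'v::linordered_ab_group_add) \<Rightarrow> ('e \<Rightarrow> 'e \<Rightarrow> 'v) \<Rightarrow>
     'f set \<Rightarrow> ('f \<Rightarrow> 'v) \<Rightarrow> ('f \<Rightarrow> 'f \<Rightarrow> 'v) \<Rightarrow> ('e \<Rightarrow> 'f) \<Rightarrow> bool" where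
  "ultra_isomorphism E w d F v c f \<longleftrightarrow>
     bij_betw f E F \<and> (\<forall>a\<in>E. v (f a) = w a) \<and>
     (\<forall>a\<in>E. \<forall>b\<in>E. a \<noteq> b \<longrightarrow> c (f a) (f b) = d a b)"

definition ultra_isomorphic ::
    "'e set \<Rightarrow> ('e \<Rightarrow> 'v::linordered_ab_group_add) \<Rightarrow> ('e \<Rightarrow> 'e \<Rightarrow> 'v) \<Rightarrow>
     'f set \<Rightarrow> ('f \<Rightarrow> 'v) \<Rightarrow> ('f \<Rightarrow> 'f \<Rightarrow> 'v) \<Rightarrow> bool" where
  "ultra_isomorphic E w d F v c \<longleftrightarrow> (\<exists>f. ultra_isomorphism E w d F v c f)"

end

theory Submission imports Defs begin

text \<open>
  For each \<open>\<alpha>\<close>, the relation ``equal or at distance less than \<open>\<alpha>\<close>'' is an equivalence on \<open>E\<close>,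
  and pairwise inequivalent points at mutual distance \<open>\<alpha>\<close> form a clique.  As \<open>'k\<close> has enough
  elements, there is a colouring \<open>k \<alpha> : E \<rightarrow> 'k\<close> constant on the classes and separating points at
  distance exactly \<open>\<alpha>\<close>.  Then \<open>a \<mapsto> u + (\<Sum>\<alpha>. k \<alpha> a t\<^sub>-\<^sub>\<alpha>)\<close>, where \<open>\<alpha>\<close> ranges over the distances
  occurring in \<open>E\<close>, is the required isomorphism: in the difference of the images of \<open>a\<close> and \<open>b\<close>
  the terms with \<open>\<alpha> > d a b\<close> cancel, and the one with \<open>\<alpha> = d a b\<close> survives.
\<close>

lemma ultra_triple_sym:
  "ultra_triple E w d \<Longrightarrow> a \<in> E \<Longrightarrow> b \<in> E \<Longrightarrow> d a b = d b a"
  by (cases "a = b") (auto simp: ultra_triple_def)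

lemma ultra_triple_le_max:
  "ultra_triple E w d \<Longrightarrow> a \<in> E \<Longrightarrow> b \<in> E \<Longrightarrow> c \<in> E \<Longrightarrow> a \<noteq> b \<Longrightarrow> a \<noteq> c \<Longrightarrow> b \<noteq> c
    \<Longrightarrow> d a b \<le> max (d a c) (d c b)"
  using ultra_triple_sym[of E w d b c] by (auto simp: ultra_triple_def)

lemma ultra_triple_subset:
  "ultra_triple E w d \<Longrightarrow> F \<subseteq> E \<Longrightarrow> ultra_triple F w d"
  unfolding ultra_triple_def by blast

text \<open>Finiteness of \<open>E\<close> leaves only finitely many clique sizes, so the
  \<open>Max\<close> defining \<open>mcs\<close> really bounds them.\<close>

lemma card_clique_le_mcs:
  assumes "finite E" and "clique E w d F"
  shows "card F \<le> mcs E w d"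
proof -
  have "{card F | F. clique E w d F} \<subseteq> card ` Pow E"
    by (auto simp: clique_def clique_at_def)
  then have "finite {card F | F. clique E w d F}"
    using \<open>finite E\<close> by (meson finite_Pow_iff finite_imageI finite_subset)
  with assms(2) show ?thesis
    unfolding mcs_def by (intro Max_ge) auto
qed

lemma clique_colouring:
  fixes d :: "'e \<Rightarrow> 'e \<Rightarrow> 'v::linordered_ab_group_add"
  assumes "finite E" and "ultra_triple E w d"
    and "\<And>F. clique_at E w d \<alpha> F \<Longrightarrow> infinite (UNIV :: 'k set) \<or> card F \<le> card (UNIV :: 'k set)"
  shows "\<exists>k :: 'e \<Rightarrow> 'k. \<forall>a\<in>E. \<forall>b\<in>E. a \<noteq> b \<longrightarrow>
    (d a b < \<alpha> \<longrightarrow> k a = k b) \<and> (d a b = \<alpha> \<longrightarrow> k a \<noteq> k b)"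
  using assms
proof (induction E rule: finite_induct)
  case empty
  then show ?case by simp
next
  case (insert x E)
  note ultra = insert.prems(1)
  have "ultra_triple E w d"
    using ultra by (rule ultra_triple_subset) auto
  moreover have "clique_at (insert x E) w d \<alpha> F" if "clique_at E w d \<alpha> F" for F
    using that by (auto simp: clique_at_def)
  ultimately obtain k :: "'e \<Rightarrow> 'k" where
    near: "\<And>a b. a \<in> E \<Longrightarrow> b \<in> E \<Longrightarrow> a \<noteq> b \<Longrightarrow> d a b < \<alpha> \<Longrightarrow> k a = k b" and
    far: "\<And>a b. a \<in> E \<Longrightarrow> b \<in> E \<Longrightarrow> a \<noteq> b \<Longrightarrow> d a b = \<alpha> \<Longrightarrow> k a \<noteq> k b"
    using insert.IH insert.prems(2) by metis
  have sym: "d a b = d b a" if "a \<in> insert x E" "b \<in> insert x E" for a b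
    using ultra_triple_sym[OF ultra] that .
  have le_max: "d a b \<le> max (d a c) (d c b)"
    if "a \<in> insert x E" "b \<in> insert x E" "c \<in> insert x E" "a \<noteq> b" "a \<noteq> c" "b \<noteq> c" for a b c
    using ultra_triple_le_max[OF ultra that] .
  have "\<exists>q. \<forall>c\<in>E. (d x c < \<alpha> \<longrightarrow> q = k c) \<and> (d x c = \<alpha> \<longrightarrow> q \<noteq> k c)"
  proof (cases "\<exists>b\<in>E. d x b < \<alpha>")
    case True
    then obtain b where b: "b \<in> E" "d x b < \<alpha>" by blast
    \<comment> \<open>The colour of \<open>b\<close> serves for \<open>x\<close>: as
      \<open>d x b < \<alpha>\<close>, the ultrametric inequality makes \<open>x\<close> and
      \<open>b\<close> indistinguishable at level \<alpha>, so the constraints on \<open>x\<close>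
      reduce to those that \<open>b\<close> already satisfies.\<close>
    have "(d x c < \<alpha> \<longrightarrow> k b = k c) \<and> (d x c = \<alpha> \<longrightarrow> k b \<noteq> k c)" if c: "c \<in> E" for c
    proof (cases "c = b")
      case False
      have "x \<noteq> b" "x \<noteq> c" using b c insert.hyps by auto
      then have "d b c \<le> max (d x b) (d x c)" "d x c \<le> max (d x b) (d b c)"
        using le_max[of b c x] le_max[of x c b] sym[of b x] b c False by auto
      then have "d x c < \<alpha> \<Longrightarrow> d b c < \<alpha>" "d x c = \<alpha> \<Longrightarrow> d b c = \<alpha>"
        using b by (auto simp: le_max_iff_disj)
      then show ?thesis
        using near[of b c] far[of b c] b c False by auto
    qed (use b in auto)
    then show ?thesis by blast
  next
    case False
    \<comment> \<open>Nothing forces a colour on \<open>x\<close> here; it only has to avoid those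
      used on \<open>S\<close>.\<close>
    define S where "S = {c \<in> E. d x c = \<alpha>}"
    have "\<exists>q. q \<notin> k ` S"
    proof (rule ccontr)
      assume "\<nexists>q. q \<notin> k ` S"
      then have surj: "k ` S = UNIV" by auto
      have "finite S" using insert.hyps by (simp add: S_def)
      \<comment> \<open>This rules out the infinite alternative in the hypothesis on
        cliques.\<close>
      then have finK: "finite (UNIV :: 'k set)" using surj by (metis finite_imageI)
      \<comment> \<open>\<open>R\<close> takes one representative of each colour. If all colours
        occur, \<open>x\<close> together with \<open>R\<close> is a clique of size one more than the
        number of colours, a contradiction.\<close>
      obtain R where R: "R \<subseteq> S" "inj_on k R" "k ` S = k ` R"
        by (metis subset_image_inj subset_refl)
      have "clique_at (insert x E) w d \<alpha> (insert x R)"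
      proof -
        have "d a b = \<alpha>" if ab: "a \<in> R" "b \<in> R" "a \<noteq> b" for a b
        proof -
          have S: "a \<in> E" "b \<in> E" "d x a = \<alpha>" "d x b = \<alpha>" "x \<noteq> a" "x \<noteq> b"
            using ab R insert.hyps by (auto simp: S_def)
          \<comment> \<open>The inequality through \<open>x\<close> bounds the distance by \<alpha>;
            a smaller distance would force equal colours by \<open>near\<close>.\<close>
          then have "d a b \<le> \<alpha>"
            using le_max[of a b x] sym[of a x] \<open>a \<noteq> b\<close> by auto
          moreover have "k a \<noteq> k b" using R(2) ab by (auto dest: inj_onD)
          ultimately show ?thesis
            using near[of a b] S \<open>a \<noteq> b\<close> by force
        qed
        then show ?thesis
          using R(1) sym by (auto simp: clique_at_def S_def)
      qed
      then have "card (insert x R) \<le> card (UNIV :: 'k set)"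
        using insert.prems(2) finK by blast
      moreover have "card (UNIV :: 'k set) = card R"
        using R surj by (metis card_image)
      moreover have "x \<notin> R" "finite R"
        using R(1) insert.hyps finite_subset[OF _ \<open>finite S\<close>] by (auto simp: S_def)
      ultimately show False by simp
    qed
    then show ?thesis
      using False by (auto simp: S_def)
  qed
  then obtain q where q: "\<And>c. c \<in> E \<Longrightarrow> d x c < \<alpha> \<Longrightarrow> q = k c"
      "\<And>c. c \<in> E \<Longrightarrow> d x c = \<alpha> \<Longrightarrow> q \<noteq> k c"
    by blast
  show ?case
  proof (intro exI[of _ "k(x := q)"] ballI impI)
    fix a b assume "a \<in> insert x E" "b \<in> insert x E" "a \<noteq> b"
    then show "(d a b < \<alpha> \<longrightarrow> (k(x := q)) a = (k(x := q)) b) \<and>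
        (d a b = \<alpha> \<longrightarrow> (k(x := q)) a \<noteq> (k(x := q)) b)"
      using q near[of a b] far[of a b] sym[of a b] by auto
  qed
qed

lemma t_order_eqI:
  assumes "Poly_Mapping.lookup p \<beta> \<noteq> 0" and "\<And>\<delta>. \<delta> < \<beta> \<Longrightarrow> Poly_Mapping.lookup p \<delta> = 0"
  shows "t_order p = \<beta>"
  unfolding t_order_def
  using assms by (intro Min_eqI) (auto intro: leI)

lemma lookup_sum_single_uminus:
  fixes g :: "'v::linordered_ab_group_add \<Rightarrow> 'k::field"
  assumes "finite D"
  shows "Poly_Mapping.lookup (\<Sum>\<alpha>\<in>D. Poly_Mapping.single (- \<alpha>) (g \<alpha>)) \<beta> =
    (if - \<beta> \<in> D then g (- \<beta>) else 0)"
proof -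
  have "Poly_Mapping.lookup (\<Sum>\<alpha>\<in>D. Poly_Mapping.single (- \<alpha>) (g \<alpha>)) \<beta> =
      (\<Sum>\<alpha>\<in>D. if - \<beta> = \<alpha> then g \<alpha> else 0)"
    by (auto simp: lookup_sum lookup_single when_def intro!: sum.cong)
  then show ?thesis using assms by simp
qed

text \<open>Pulling out \<open>t (- \<gamma>)\<close> shifts each exponent to
  \<open>\<gamma> - \<alpha>\<close>, which is nonnegative.\<close>

lemma sum_single_positioned:
  fixes g :: "'v::linordered_ab_group_add \<Rightarrow> 'k::field"
  assumes "\<And>\<alpha>. \<alpha> \<in> D \<Longrightarrow> \<alpha> \<le> \<gamma>"
  shows "\<exists>p\<in>L_plus. (\<Sum>\<alpha>\<in>D. Poly_Mapping.single (- \<alpha>) (g \<alpha>)) = t (- \<gamma>) * p"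
proof
  define p where "p = (\<Sum>\<alpha>\<in>D. Poly_Mapping.single (\<gamma> - \<alpha>) (g \<alpha>))"
  have "Poly_Mapping.keys p \<subseteq> (\<Union>\<alpha>\<in>D. Poly_Mapping.keys (Poly_Mapping.single (\<gamma> - \<alpha>) (g \<alpha>)))"
    unfolding p_def by (rule keys_sum)
  then show "p \<in> L_plus"
    using assms by (fastforce simp: L_plus_def split: if_splits)
  show "(\<Sum>\<alpha>\<in>D. Poly_Mapping.single (- \<alpha>) (g \<alpha>)) = t (- \<gamma>) * p"
    by (simp add: p_def t_def sum_distrib_left mult_single)
qed

text \<open>Transport of structure along \<open>f\<close>: the weights are pulled back by the
  inverse of \<open>f\<close>, and the ultrametric axioms for \<open>c\<close> are those for
  \<open>d\<close> read through \<open>f\<close>.\<close>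

lemma ultra_isomorphism_valadic:
  assumes ultra: "ultra_triple E w d"
    and inj: "inj_on f E"
    and ord: "\<And>a b. a \<in> E \<Longrightarrow> b \<in> E \<Longrightarrow> a \<noteq> b \<Longrightarrow> - t_order (f a - f b) = d a b"
  defines "v \<equiv> \<lambda>a. w (inv_into E f a)"
    and "c \<equiv> \<lambda>a b. - t_order (a - b)"
  shows "valadic (f ` E) v c" and "ultra_isomorphism E w d (f ` E) v c f"
proof -
  have c: "c (f a) (f b) = d a b" if "a \<in> E" "b \<in> E" "a \<noteq> b" for a b
    using ord[OF that] by (simp add: c_def)
  have "ultra_triple (f ` E) v c"
    unfolding ultra_triple_def
  proof (intro conjI ballI impI; elim imageE conjE; hypsubst)
    fix a b assume "a \<in> E" "b \<in> E" "f a \<noteq> f b"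
    then show "c (f a) (f b) = c (f b) (f a)"
      using c[of a b] c[of b a] ultra_triple_sym[OF ultra, of a b] by metis
  next
    fix a b e assume "a \<in> E" "b \<in> E" "e \<in> E" "f a \<noteq> f b" "f a \<noteq> f e" "f b \<noteq> f e"
    then show "c (f a) (f b) \<le> max (c (f a) (f e)) (c (f b) (f e))"
      using c[of a b] c[of a e] c[of b e] ultra unfolding ultra_triple_def by metis
  qed
  then show "valadic (f ` E) v c"
    by (simp add: valadic_def c_def)
  show "ultra_isomorphism E w d (f ` E) v c f"
    using inj by (simp add: ultra_isomorphism_def v_def c inj_on_imp_bij_betw)
qed

theorem theorem9p2:
  fixes E :: "'e set"
    and w :: "'e \<Rightarrow> 'v::linordered_ab_group_add"
    and d :: "'e \<Rightarrow> 'e \<Rightarrow> 'v"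
    and \<gamma> :: 'v
    and u :: "'v \<Rightarrow>\<^sub>0 'k::field"
  assumes "ultra_triple E w d"
    and "finite E"
    and "\<And>a b. a \<in> E \<Longrightarrow> b \<in> E \<Longrightarrow> a \<noteq> b \<Longrightarrow> d a b \<le> \<gamma>"
    and "infinite (UNIV :: 'k set) \<or> mcs E w d \<le> card (UNIV :: 'k set)"
  shows "\<exists>(F :: ('v \<Rightarrow>\<^sub>0 'k) set) v c.
    valadic F v c \<and> positioned \<gamma> u F v c \<and> ultra_isomorphic E w d F v c"
proof -
  have "infinite (UNIV :: 'k set) \<or> card F \<le> card (UNIV :: 'k set)"
    if "clique_at E w d \<alpha> F" for \<alpha> F
  proof -
    have "card F \<le> mcs E w d"
      using that by (intro card_clique_le_mcs[OF \<open>finite E\<close>]) (auto simp: clique_def)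
    then show ?thesis using assms(4) by linarith
  qed
  then have "\<forall>\<alpha>. \<exists>k :: 'e \<Rightarrow> 'k. \<forall>a\<in>E. \<forall>b\<in>E. a \<noteq> b \<longrightarrow>
      (d a b < \<alpha> \<longrightarrow> k a = k b) \<and> (d a b = \<alpha> \<longrightarrow> k a \<noteq> k b)"
    by (intro allI clique_colouring[OF assms(2,1)])
  from choice[OF this] obtain k :: "'v \<Rightarrow> 'e \<Rightarrow> 'k" where k: "\<forall>\<alpha>. \<forall>a\<in>E. \<forall>b\<in>E. a \<noteq> b \<longrightarrow>
      (d a b < \<alpha> \<longrightarrow> k \<alpha> a = k \<alpha> b) \<and> (d a b = \<alpha> \<longrightarrow> k \<alpha> a \<noteq> k \<alpha> b)"
    by (rule exE)
  have near: "k \<alpha> a = k \<alpha> b" if "a \<in> E" "b \<in> E" "a \<noteq> b" "d a b < \<alpha>" for \<alpha> a b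
    using k that by blast
  have far: "k (d a b) a \<noteq> k (d a b) b" if "a \<in> E" "b \<in> E" "a \<noteq> b" for a b
    using k that by blast
  \<comment> \<open>Only distances between distinct points enter, since these alone are bounded by
    \<gamma>; finiteness of \<open>D\<close> makes the sum below an element of the group
    algebra.\<close>
  define D where "D = (\<lambda>(a, b). d a b) ` {(a, b) \<in> E \<times> E. a \<noteq> b}"
  have "finite D"
    unfolding D_def
    by (rule finite_imageI, rule finite_subset[of _ "E \<times> E"]) (use \<open>finite E\<close> in auto)
  define f where "f = (\<lambda>a. u + (\<Sum>\<alpha>\<in>D. Poly_Mapping.single (- \<alpha>) (k \<alpha> a)))"
  have coeff: "Poly_Mapping.lookup (f a - f b) \<beta> =
      (if - \<beta> \<in> D then k (- \<beta>) a - k (- \<beta>) b else 0)" for a b \<beta>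
    by (simp add: f_def lookup_minus lookup_add lookup_sum_single_uminus \<open>finite D\<close>)
  have leading: "Poly_Mapping.lookup (f a - f b) (- d a b) \<noteq> 0" if "a \<in> E" "b \<in> E" "a \<noteq> b" for a b
  proof -
    have "d a b \<in> D" using that by (auto simp: D_def)
    then show ?thesis using far[OF that] by (simp add: coeff)
  qed
  \<comment> \<open>Injectivity follows from a nonzero coefficient of the difference rather than
    from \<open>t_order\<close>, which is meaningless at 0.\<close>
  have "inj_on f E"
  proof (rule inj_onI, rule ccontr)
    fix a b assume "a \<in> E" "b \<in> E" "f a = f b" "a \<noteq> b"
    with leading[of a b] show False by simp
  qed
  moreover have "- t_order (f a - f b) = d a b" if ab: "a \<in> E" "b \<in> E" "a \<noteq> b" for a b
  proof -
    \<comment> \<open>Negation reverses the order: an exponent below \<open>- d a b\<close> belongs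
      to a level above \<open>d a b\<close>, where the colours of \<open>a\<close> and
      \<open>b\<close> agree.\<close>
    have "Poly_Mapping.lookup (f a - f b) \<delta> = 0" if "\<delta> < - d a b" for \<delta>
    proof -
      have "d a b < - \<delta>" using that by (metis less_minus_iff)
      then show ?thesis using near[OF ab, of "- \<delta>"] by (simp add: coeff)
    qed
    then have "t_order (f a - f b) = - d a b"
      using leading[OF ab] by (intro t_order_eqI)
    then show ?thesis by simp
  qed
  ultimately obtain v c where "valadic (f ` E) v c" "ultra_isomorphism E w d (f ` E) v c f"
    using ultra_isomorphism_valadic[OF assms(1)] by blast
  moreover have "positioned \<gamma> u (f ` E) v c"
  proof -
    have "\<alpha> \<le> \<gamma>" if "\<alpha> \<in> D" for \<alpha>
      using that assms(3) by (auto simp: D_def)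
    then have "\<exists>p\<in>L_plus. f a = u + t (- \<gamma>) * p" for a
      using sum_single_positioned[of D \<gamma> "\<lambda>\<alpha>. k \<alpha> a"] by (auto simp: f_def)
    then show ?thesis unfolding positioned_def by blast
  qed
  ultimately show ?thesis
    unfolding ultra_isomorphic_def by blast
qed

end
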